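(* Let $\mathcal B$ be a unital Banach algebra, $T>0$, $p\ge 1$ an integer, $L,R\in\mathcal B$ with $[L,R]=LR-RL=0$, $N:\mathcal B\times[0,T]\to\mathcal B$, and let $Q:[0,T]\to\mathcal B$ be the exact solution of $$\dot Q(t)=LQ(t)+Q(t)R+N(Q(t),t),\qquad Q(0)=Q_0 .$$ Assume that: (1) $L$ and $R$ are bounded (elements of $\mathcal B$), and $L$, $R$ and $L+R$ are infinitesimal generators of analytic semigroups $e^{tL}$, $e^{tR}$, $e^{t(L+R)}$ (so that there are constants $C'>0$, $\omega\in\mathbb R$ with $\|e^{tL}\|\le C'e^{\omega t}$ for $t\ge 0$, and similarly for $R$ and $L+R$); (2) $N$ is globally Lipschitz continuous on a strip along the exact solution, i.e. there are $\rho>0$ and $L_N\ge 0$ such that $\|N(X,t)-N(Y,t)\|\le L_N\|X-Y\|$ for all $t\in[0,T]$ and all $X,Y\in\mathcal B$ with $\|X-Q(t)\|\le\rho$, $\|Y-Q(t)\|\le\rho$; moreover the map $t\mapsto N(Q(t),t)$ is $C^p$ on $[0,T]$ and its derivatives up to order $p$ are uniformly bounded on $[0,T]$. For a step size $h>0$ and $t_n=nh$, let $I_p$ be the METD$p$ increment defined in the context, and define the one-step defect $\delta_{n+1}$ (for $n\ge p-1$, $t_{n+1}\le T$) by inserting the exact solution into the METD$p$ update: $$Q(t_{n+1})=e^{hL}Q(t_n)e^{hR}+I_p\bigl(Q(t_n),\dots,Q(t_{n-p+1})\bigr)+\delta_{n+1}.$$ Then there exists a constant $C$, independent of $h$ and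 of $n$ (with $t_{n+1}\le T$), such that $$\|\delta_{n+1}\|\le C\,h^{p+1}.$$ In particular, the METD$p$ scheme is consistent of order $p$.
   Context: A Banach algebra here is a (real or complex) Banach space $(\mathcal B,\|\cdot\|)$ with an associative unital multiplication satisfying $\|xy\|\le\|x\|\,\|y\|$; the commutator is $[x,y]=xy-yx$. The motivating case is $\mathcal B=\mathbb R^{n\times n}$ (or complex matrices). Notation for the METD$p$ scheme: - $\varphi$-functions: $\varphi_0(A)=e^A$ and $\varphi_k(A)=\int_0^1 e^{(1-\theta)A}\frac{\theta^{k-1}}{(k-1)!}\,d\theta$ for $k\ge1$, $A\in\mathcal B$. - $\mathrm{ad}_R(X)=[X,R]=XR-RX$, and $\mathrm{ad}_R^{\,j}$ denotes its $j$-fold iterate ($\mathrm{ad}_R^{\,0}(X)=X$). - For integers $m,j\ge0$, $\alpha_{m,j,q}$ ($0\le q\le m+j$) are the real numbers defined by the polynomial identity $(1-\theta)^j\binom{-\theta}{m}=\sum_{q=0}^{m+j}\alpha_{m,j,q}\theta^q$, where $\binom{-\theta}{m}=\frac{(-\theta)(-\theta-1)\cdots(-\theta-m+1)}{m!}$ (equal to $1$ for $m=0$). Set $$C_{m,j}(A)=\frac{(-1)^m}{j!}\sum_{q=0}^{m+j}\alpha_{m,j,q}\,q!\,\varphi_{q+1}(A).$$ - For values $X_n,X_{n-1},\dots,X_{n-p+1}\in\mathcal B$ at times $t_n,\dots,t_{n-p+1}$, put $N_k=N(X_k,t_k)$ and define the backward differences $\nabla^mN_n=\sum_{\ell=0}^m(-1)^\ell\binom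 m\ell N_{n-\ell}$ (so $\nabla^0N_n=N_n$). The METD$p$ increment is $$I_p(X_n,\dots,X_{n-p+1})=h\sum_{m=0}^{p-1}\sum_{j=0}^{p-1-m}h^j\,C_{m,j}(A)\,\mathrm{ad}_R^{\,j}\bigl(\nabla^mN_n\bigr),\qquad A=h(L+R),$$ where $C_{m,j}(A)$ acts by left multiplication. The METD$p$ scheme is $Q_{n+1}=e^{hL}Q_ne^{hR}+I_p(Q_n,\dots,Q_{n-p+1})$. "Consistent of order $p$" means that the one-step defect is $\mathcal O(h^{p+1})$ uniformly in $n$ with $t_{n+1}\le T$. *)

theory Defs
  imports "HOL-Analysis.Analysis"
begin

text \<open>
  Unital Banach algebras are rendered by the sort
  \<open>{real_normed_algebra, real_algebra_1, banach}\<close>. The class \<open>real_normed_algebra_1\<close> would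
  additionally impose \<open>norm 1 = 1\<close>, which fails e.g. for matrices with the Frobenius norm.
  Complex Banach algebras are covered by restriction of scalars. As the library function \<open>exp\<close>
  lives in \<open>real_normed_algebra_1\<close>, the exponential series is restated at the more general sort.
\<close>

definition bexp :: "'a::{real_normed_algebra, real_algebra_1, banach} \<Rightarrow> 'a" where
  "bexp A = (\<Sum>k. A ^ k /\<^sub>R fact k)"

lemma bexp_eq_exp: "bexp A = exp A"
  for A :: "'a::{real_normed_algebra_1, banach}"
  by (simp add: bexp_def exp_def)


subsection \<open>Analytic semigroups\<close>

text \<open>
  A pair \<open>(a, b)\<close> stands for \<open>a + \<i>b\<close> in the complexification of the algebra, with
  multiplication \<open>cplx_mult\<close>; \<open>cplx_i\<close> is multiplication by \<open>\<i>\<close>. The product norm is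
  equivalent to every reasonable norm on the complexification.

  An element of the algebra acts by left multiplication. Since the algebra is unital, strong
  convergence of left multiplications is the same as norm convergence of the elements.
\<close>

definition cplx_mult ::
  "'a \<times> 'a \<Rightarrow> 'a \<times> 'a \<Rightarrow> ('a::{real_normed_algebra, real_algebra_1, banach}) \<times> 'a" where
  "cplx_mult x y = (fst x * fst y - snd x * snd y, fst x * snd y + snd x * fst y)"

definition cplx_i :: "'a \<times> 'a \<Rightarrow> ('a::{real_normed_algebra, real_algebra_1, banach}) \<times> 'a" where
  "cplx_i x = (- snd x, fst x)"

definition sector :: "real \<Rightarrow> complex set" where
  "sector \<beta> = {z. z \<noteq> 0 \<and> \<bar>Arg z\<bar> < \<beta>}"

definition analytic_semigroup ::
  "(complex \<Rightarrow> ('a::{real_normed_algebra, real_algebra_1, banach}) \<times> 'a) \<Rightarrow> bool" where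
  "analytic_semigroup S \<longleftrightarrow> (\<exists>\<beta>. 0 < \<beta> \<and> \<beta> \<le> pi / 2 \<and>
     (\<forall>z\<in>sector \<beta>. \<exists>S'. (S has_derivative S') (at z) \<and> (\<forall>w. S' (\<i> * w) = cplx_i (S' w))) \<and>
     S 0 = (1, 0) \<and> (S \<longlongrightarrow> (1, 0)) (at 0 within sector \<beta>) \<and>
     (\<forall>z\<in>sector \<beta>. \<forall>w\<in>sector \<beta>. S (z + w) = cplx_mult (S z) (S w)))"

definition generates_analytic_semigroup ::
  "'a::{real_normed_algebra, real_algebra_1, banach} \<Rightarrow> bool" where
  "generates_analytic_semigroup L \<longleftrightarrow> (\<exists>S. analytic_semigroup S \<and>
     ((\<lambda>t. (S (complex_of_real t) - (1, 0)) /\<^sub>R t) \<longlongrightarrow> (L, 0)) (at_right 0))"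


subsection \<open>Functions of class \<open>C\<^sup>k\<close>\<close>

text \<open>
  Derivatives are taken relative to \<open>S\<close>, hence one-sided at the end points of an interval.
\<close>

primrec nth_vector_derivative ::
  "nat \<Rightarrow> (real \<Rightarrow> 'a::real_normed_vector) \<Rightarrow> real set \<Rightarrow> real \<Rightarrow> 'a" where
  "nth_vector_derivative 0 f S = f"
| "nth_vector_derivative (Suc k) f S =
     (\<lambda>t. vector_derivative (nth_vector_derivative k f S) (at t within S))"

definition Ck_on :: "nat \<Rightarrow> (real \<Rightarrow> 'a::real_normed_vector) \<Rightarrow> real set \<Rightarrow> bool" where
  "Ck_on k f S \<longleftrightarrow>
     (\<forall>i<k. \<forall>t\<in>S. nth_vector_derivative i f S differentiable (at t within S)) \<and>
     (\<forall>i\<le>k. continuous_on S (nth_vector_derivative i f S))"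


subsection \<open>The METD scheme\<close>

definition phi :: "nat \<Rightarrow> 'a \<Rightarrow> 'a::{real_normed_algebra, real_algebra_1, banach}" where
  "phi k A = (if k = 0 then bexp A else
     integral {0..1} (\<lambda>\<theta>. (\<theta> ^ (k - 1) / fact (k - 1)) *\<^sub>R bexp ((1 - \<theta>) *\<^sub>R A)))"

definition ad :: "'a \<Rightarrow> 'a \<Rightarrow> 'a::{real_normed_algebra, real_algebra_1, banach}" where
  "ad R X = X * R - R * X"

definition alpha_poly :: "nat \<Rightarrow> nat \<Rightarrow> real poly" where
  "alpha_poly m j = [:1, -1:] ^ j * smult (1 / fact m) (\<Prod>i<m. [:- real i, -1:])"

definition alpha :: "nat \<Rightarrow> nat \<Rightarrow> nat \<Rightarrow> real" where
  "alpha m j q = coeff (alpha_poly m j) q"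

lemma poly_alpha_poly: "poly (alpha_poly m j) \<theta> = (1 - \<theta>) ^ j * ((- \<theta>) gchoose m)"
proof -
  have "(\<Prod>i<m. - real i - \<theta>) = (\<Prod>i = 0..<m. - \<theta> - real i)"
    by (intro prod.cong) auto
  then show ?thesis
    by (simp add: alpha_poly_def poly_prod gbinomial_prod_rev)
qed

lemma degree_alpha_poly: "degree (alpha_poly m j) = m + j"
proof -
  have "degree (\<Prod>i<m. [:- real i, -1:]) = m"
    by (subst degree_prod_sum_eq) simp_all
  moreover have "(\<Prod>i<m. [:- real i, -1:]) \<noteq> 0"
    by simp
  ultimately show ?thesis
    by (simp add: alpha_poly_def degree_mult_eq degree_power_eq)
qed

lemma alpha_identity:
  "(1 - \<theta>) ^ j * ((- \<theta>) gchoose m) = (\<Sum>q\<le>m + j. alpha m j q * \<theta> ^ q)"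
  by (simp add: poly_alpha_poly [symmetric] poly_altdef degree_alpha_poly alpha_def)

definition metd_coeff ::
  "nat \<Rightarrow> nat \<Rightarrow> 'a \<Rightarrow> 'a::{real_normed_algebra, real_algebra_1, banach}" where
  "metd_coeff m j A =
     ((-1) ^ m / fact j) *\<^sub>R (\<Sum>q\<le>m + j. (alpha m j q * fact q) *\<^sub>R phi (q + 1) A)"

text \<open>
  The index \<open>n - l\<close> is truncated subtraction; the scheme only uses \<open>m \<le> p - 1 \<le> n\<close>.
\<close>

definition backward_diff :: "nat \<Rightarrow> (nat \<Rightarrow> 'a::real_vector) \<Rightarrow> nat \<Rightarrow> 'a" where
  "backward_diff m F n = (\<Sum>l\<le>m. ((-1) ^ l * real (m choose l)) *\<^sub>R F (n - l))"

text \<open>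
  In the following, \<open>X k\<close> is the value at time \<open>t\<^sub>k = k h\<close>; of the sequence \<open>X\<close>, only
  \<open>X n, \<dots>, X (n - p + 1)\<close> enter.
\<close>

definition metd_increment ::
  "nat \<Rightarrow> 'a \<Rightarrow> 'a \<Rightarrow> ('a \<Rightarrow> real \<Rightarrow> 'a) \<Rightarrow> real \<Rightarrow> (nat \<Rightarrow> 'a) \<Rightarrow> nat
     \<Rightarrow> 'a::{real_normed_algebra, real_algebra_1, banach}" where
  "metd_increment p L R N h X n =
     h *\<^sub>R (\<Sum>m\<in>{0..<p}. \<Sum>j\<in>{0..p - 1 - m}.
       h ^ j *\<^sub>R (metd_coeff m j (h *\<^sub>R (L + R)) *
         (ad R ^^ j) (backward_diff m (\<lambda>k. N (X k) (real k * h)) n)))"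

definition metd_step ::
  "nat \<Rightarrow> 'a \<Rightarrow> 'a \<Rightarrow> ('a \<Rightarrow> real \<Rightarrow> 'a) \<Rightarrow> real \<Rightarrow> (nat \<Rightarrow> 'a) \<Rightarrow> nat
     \<Rightarrow> 'a::{real_normed_algebra, real_algebra_1, banach}" where
  "metd_step p L R N h X n =
     bexp (h *\<^sub>R L) * X n * bexp (h *\<^sub>R R) + metd_increment p L R N h X n"

text \<open>The one-step defect \<open>\<delta>\<^bsub>n+1\<^esub>\<close> of a function \<open>Q\<close> for step size \<open>h\<close>.\<close>

definition metd_defect ::
  "nat \<Rightarrow> 'a \<Rightarrow> 'a \<Rightarrow> ('a \<Rightarrow> real \<Rightarrow> 'a) \<Rightarrow> (real \<Rightarrow> 'a) \<Rightarrow> real \<Rightarrow> nat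
     \<Rightarrow> 'a::{real_normed_algebra, real_algebra_1, banach}" where
  "metd_defect p L R N Q h n =
     Q (real (n + 1) * h) - metd_step p L R N h (\<lambda>k. Q (real k * h)) n"

text \<open>
  Consistency of order \<open>r\<close> of the \<open>p\<close>-step scheme along \<open>Q\<close>: the defect is \<open>O(h\<^bsup>r+1\<^esup>)\<close> as
  \<open>h \<rightarrow> 0\<close>, uniformly in the admissible \<open>n\<close>.
\<close>

definition metd_consistent ::
  "nat \<Rightarrow> nat \<Rightarrow> real \<Rightarrow> 'a \<Rightarrow> 'a \<Rightarrow> ('a \<Rightarrow> real \<Rightarrow> 'a)
     \<Rightarrow> (real \<Rightarrow> 'a::{real_normed_algebra, real_algebra_1, banach}) \<Rightarrow> bool" where
  "metd_consistent r p T L R N Q \<longleftrightarrow>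
     (\<exists>C. \<forall>\<^sub>F h in at_right 0. \<forall>n. p - 1 \<le> n \<longrightarrow> real (n + 1) * h \<le> T \<longrightarrow>
        norm (metd_defect p L R N Q h n) \<le> C * h ^ (r + 1))"

end

theory Submission
  imports Defs
begin

text \<open>
  Write \<open>M = L + R\<close> and let \<open>f t = N (Q t) t\<close>. By variation of constants the exact solution
  satisfies, with \<open>s = (1 - \<theta>) h\<close> and \<open>t = n h\<close>,

  \<open>Q (t + h) = e\<^bsup>hL\<^esup> Q(t) e\<^bsup>hR\<^esup> + h \<integral> e\<^bsup>sL\<^esup> f(t + \<theta> h) e\<^bsup>sR\<^esup> d\<theta>\<close>, \<open>\<theta>\<close> from \<open>0\<close> to \<open>1\<close>.

  The METD increment is the same integral after two approximations, so the defect is the integral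
  of their errors. First, \<open>f(t + \<theta> h)\<close> is replaced by Newton's backward interpolant. Second, since
  \<open>L\<close> and \<open>R\<close> commute, \<open>e\<^bsup>sL\<^esup> X e\<^bsup>sR\<^esup> = e\<^bsup>sM\<^esup> (e\<^bsup>-sR\<^esup> X e\<^bsup>sR\<^esup>)\<close>, and the conjugate of \<open>X\<close> has the
  Taylor series \<open>\<Sum>j. s\<^sup>j / j! (ad R ^^ j) X\<close>; on the \<open>m\<close>-th backward difference this series is cut
  off after \<open>p - m\<close> terms. The interpolation error is \<open>O(h\<^sup>p)\<close>
  (\<open>newton_backward_error_power\<close>), because \<open>f\<close> differs from a Taylor polynomial of degree below
  \<open>p\<close> by \<open>O(h\<^sup>p)\<close> on the stencil and interpolation reproduces that polynomial. The cut-off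
  costs \<open>O(h\<^bsup>p-m\<^esup>)\<close> times the norm of the difference (\<open>bexp_sandwich_expansion\<close>), and the
  difference is \<open>O(h\<^sup>m)\<close> (\<open>norm_backward_difference_le_power\<close>). Both errors are \<open>O(h\<^sup>p)\<close>,
  and the factor \<open>h\<close> in front of the integral gives the order \<open>p + 1\<close>.

  The Taylor series with its remainder comes from the linear equation \<open>u' = ad R u\<close>, which
  \<open>u(s) = e\<^bsup>-sM\<^esup> e\<^bsup>sL\<^esup> X e\<^bsup>sR\<^esup>\<close> solves because \<open>L\<close> and \<open>R\<close> commute.
\<close>

section \<open>The exponential in a Banach algebra\<close>

text \<open>
  As \<open>norm 1\<close> may exceed \<open>1\<close>, the factor \<open>norm 1\<close> cannot be dropped: it accounts for the
  case \<open>k = 0\<close> and is carried along through all bounds on the exponential.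
\<close>

lemma norm_power_le:
  fixes A :: "'a::{real_normed_algebra, real_algebra_1}"
  shows "norm (A ^ k) \<le> norm (1::'a) * norm A ^ k"
proof (induction k)
  case (Suc k)
  have "norm (A ^ Suc k) \<le> norm A * norm (A ^ k)"
    by (simp add: norm_mult_ineq)
  also have "\<dots> \<le> norm A * (norm (1::'a) * norm A ^ k)"
    by (intro mult_left_mono Suc) simp
  finally show ?case by (simp add: mult_ac)
qed simp

lemma power_scaleR_eq: "(t *\<^sub>R A) ^ n = t ^ n *\<^sub>R A ^ n"
  for A :: "'a::real_algebra_1"
  by (induction n) simp_all

lemma norm_bexp_term_le:
  fixes A :: "'a::{real_normed_algebra, real_algebra_1, banach}"
  shows "norm (A ^ k /\<^sub>R fact k) \<le> norm (1::'a) * (norm A ^ k /\<^sub>R fact k)"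
  using mult_left_mono[OF norm_power_le[of A k], of "inverse (fact k)"]
  by (simp add: mult_ac)

lemma summable_norm_bexp:
  fixes A :: "'a::{real_normed_algebra, real_algebra_1, banach}"
  shows "summable (\<lambda>k. norm (A ^ k /\<^sub>R fact k))"
proof (rule summable_comparison_test')
  show "summable (\<lambda>k. norm (1::'a) * (norm A ^ k /\<^sub>R fact k))"
    by (intro summable_mult summable_exp_generic)
  show "\<And>k. k \<ge> 0 \<Longrightarrow> norm (norm (A ^ k /\<^sub>R fact k)) \<le> norm (1::'a) * (norm A ^ k /\<^sub>R fact k)"
    using norm_bexp_term_le[where A = A] by simp
qed

lemma summable_bexp:
  fixes A :: "'a::{real_normed_algebra, real_algebra_1, banach}"
  shows "summable (\<lambda>k. A ^ k /\<^sub>R fact k)"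
  by (rule summable_norm_cancel) (rule summable_norm_bexp)

lemma norm_bexp_le:
  fixes A :: "'a::{real_normed_algebra, real_algebra_1, banach}"
  shows "norm (bexp A) \<le> norm (1::'a) * exp (norm A)"
proof -
  have "norm (bexp A) \<le> (\<Sum>k. norm (A ^ k /\<^sub>R fact k))"
    unfolding bexp_def by (rule summable_norm) (rule summable_norm_bexp)
  also have "\<dots> \<le> (\<Sum>k. norm (1::'a) * (norm A ^ k /\<^sub>R fact k))"
    by (intro suminf_le norm_bexp_term_le summable_norm_bexp summable_mult summable_exp_generic)
  also have "\<dots> = norm (1::'a) * exp (norm A)"
    unfolding exp_def by (intro suminf_mult summable_exp_generic)
  finally show ?thesis .
qed

lemma bexp_0 [simp]: "bexp 0 = (1::'a::{real_normed_algebra, real_algebra_1, banach})"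
proof -
  have "(\<Sum>k. (0::'a) ^ k /\<^sub>R fact k) = (\<Sum>k\<in>{0}. (0::'a) ^ k /\<^sub>R fact k)"
    by (rule suminf_finite) (auto simp: power_0_left)
  then show ?thesis by (simp add: bexp_def)
qed

lemma bexp_commute:
  fixes A B :: "'a::{real_normed_algebra, real_algebra_1, banach}"
  assumes "A * B = B * A"
  shows "bexp A * B = B * bexp A"
proof -
  have pw: "A ^ k * B = B * A ^ k" for k
    using assms by (induction k) (simp_all add: mult.assoc, metis mult.assoc)
  have "bexp A * B = (\<Sum>k. (A ^ k /\<^sub>R fact k) * B)"
    unfolding bexp_def by (rule bounded_linear.suminf[OF bounded_linear_mult_left summable_bexp])
  also have "\<dots> = (\<Sum>k. B * (A ^ k /\<^sub>R fact k))"
    by (simp add: pw)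
  also have "\<dots> = B * bexp A"
    unfolding bexp_def
    by (rule bounded_linear.suminf[OF bounded_linear_mult_right summable_bexp, symmetric])
  finally show ?thesis .
qed

text \<open>
  Term-by-term differentiation shifts the partial sums of the exponential series by one index,
  so the differentiated series inherits the uniform convergence of the series itself.
\<close>

lemma sum_deriv_bexp_term:
  fixes A :: "'a::{real_normed_algebra, real_algebra_1}"
  shows "(\<Sum>i<Suc n. (real i * t ^ (i - 1) / fact i) *\<^sub>R A ^ i)
           = A * (\<Sum>i<n. (t *\<^sub>R A) ^ i /\<^sub>R fact i)"
proof -
  have "(\<Sum>i<Suc n. (real i * t ^ (i - 1) / fact i) *\<^sub>R A ^ i)
      = (\<Sum>i<n. (real (Suc i) * t ^ i / fact (Suc i)) *\<^sub>R A ^ Suc i)"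
    by (subst sum.lessThan_Suc_shift) simp
  also have "\<dots> = (\<Sum>i<n. A * ((t *\<^sub>R A) ^ i /\<^sub>R fact i))"
  proof (rule sum.cong)
    fix i
    have "real (Suc i) * t ^ i / fact (Suc i) = t ^ i / fact i"
      by (simp add: fact_Suc del: of_nat_Suc)
    then show "(real (Suc i) * t ^ i / fact (Suc i)) *\<^sub>R A ^ Suc i = A * ((t *\<^sub>R A) ^ i /\<^sub>R fact i)"
      by (simp add: divide_inverse_commute power_scaleR_eq)
  qed simp
  finally show ?thesis by (simp add: sum_distrib_left)
qed

lemma uniform_limit_bexp:
  fixes A :: "'a::{real_normed_algebra, real_algebra_1, banach}"
  shows "uniform_limit {-r..r} (\<lambda>n t. \<Sum>i<n. (t *\<^sub>R A) ^ i /\<^sub>R fact i)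
           (\<lambda>t. bexp (t *\<^sub>R A)) sequentially"
  unfolding bexp_def
proof (rule Weierstrass_m_test)
  show "summable (\<lambda>k. norm (1::'a) * ((r * norm A) ^ k /\<^sub>R fact k))"
    by (intro summable_mult summable_exp_generic)
  fix k t assume t: "t \<in> {-r..r}"
  have "norm ((t *\<^sub>R A) ^ k /\<^sub>R fact k) \<le> norm (1::'a) * (norm (t *\<^sub>R A) ^ k /\<^sub>R fact k)"
    by (rule norm_bexp_term_le)
  also have "\<dots> \<le> norm (1::'a) * ((r * norm A) ^ k /\<^sub>R fact k)"
    using t by (intro mult_left_mono scaleR_left_mono power_mono) (auto intro!: mult_right_mono)
  finally show "norm ((t *\<^sub>R A) ^ k /\<^sub>R fact k) \<le> norm (1::'a) * ((r * norm A) ^ k /\<^sub>R fact k)" .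
qed

lemma bexp_has_vector_derivative:
  fixes A :: "'a::{real_normed_algebra, real_algebra_1, banach}"
  shows "((\<lambda>t. bexp (t *\<^sub>R A)) has_vector_derivative A * bexp (t *\<^sub>R A)) (at t within S)"
proof -
  define r where "r = \<bar>t\<bar> + 1"
  define I where "I = {-r<..<r}"
  define f where "f = (\<lambda>i t. (t *\<^sub>R A) ^ i /\<^sub>R fact i)"
  define f' where "f' = (\<lambda>i t. (real i * t ^ (i - 1) / fact i) *\<^sub>R A ^ i)"
  have tI: "t \<in> I" by (auto simp: I_def r_def)
  have sm: "(\<lambda>i. f i x) sums bexp (x *\<^sub>R A)" for x
    using summable_sums[OF summable_bexp[of "x *\<^sub>R A"]] by (simp add: f_def bexp_def)
  have df: "(f n has_derivative (\<lambda>h. h *\<^sub>R f' n x)) (at x within I)" for n x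
  proof -
    have "((\<lambda>t. t ^ n / fact n) has_real_derivative real n * x ^ (n - 1) / fact n) (at x within I)"
      by (auto intro!: derivative_eq_intros)
    then have "((\<lambda>t. (t ^ n / fact n) *\<^sub>R A ^ n) has_vector_derivative f' n x) (at x within I)"
      unfolding f'_def
      by (auto intro!: derivative_eq_intros simp: has_real_derivative_iff_has_vector_derivative)
    moreover have "(\<lambda>t. (t ^ n / fact n) *\<^sub>R A ^ n) = f n"
      by (simp add: f_def divide_inverse_commute power_scaleR_eq)
    ultimately show ?thesis by (simp add: has_vector_derivative_def)
  qed
  have "uniform_limit I (\<lambda>n x. \<Sum>i<n. f i x) (\<lambda>x. bexp (x *\<^sub>R A)) sequentially"
    unfolding f_def
    by (rule uniform_limit_on_subset[OF uniform_limit_bexp[where r = r and A = A]])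
       (auto simp: I_def)
  from bounded_linear.uniform_limit[OF bounded_linear_mult_right this, of A]
  have "uniform_limit I (\<lambda>n x. A * (\<Sum>i<n. f i x)) (\<lambda>x. A * bexp (x *\<^sub>R A)) sequentially" .
  then have "uniform_limit I (\<lambda>n x. \<Sum>i<Suc n. f' i x) (\<lambda>x. A * bexp (x *\<^sub>R A)) sequentially"
    unfolding f'_def f_def sum_deriv_bexp_term .
  then have "uniform_limit I (\<lambda>n x. \<Sum>i<n. f' i x) (\<lambda>x. A * bexp (x *\<^sub>R A)) sequentially"
    by (rule filterlim_sequentially_Suc[where f = "\<lambda>n x. \<Sum>i<n. f' i x", THEN iffD1])
  then have ul: "\<forall>\<^sub>F n in sequentially. \<forall>x\<in>I. norm ((\<Sum>i<n. f' i x) - A * bexp (x *\<^sub>R A)) < e"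
    if "e > 0" for e
    using that by (simp add: uniform_limit_iff dist_norm)
  have "\<exists>g. \<forall>x\<in>I. (\<lambda>n. f n x) sums g x \<and>
          (g has_derivative (\<lambda>h. h *\<^sub>R (A * bexp (x *\<^sub>R A)))) (at x within I)"
  proof (rule has_derivative_series[OF _ df _ tI sm])
    fix e :: real assume "e > 0"
    from ul[OF this] show "\<forall>\<^sub>F n in sequentially. \<forall>x\<in>I. \<forall>h.
        norm ((\<Sum>i<n. h *\<^sub>R f' i x) - h *\<^sub>R (A * bexp (x *\<^sub>R A))) \<le> e * norm h"
    proof eventually_elim
      case (elim n)
      show ?case
      proof (intro ballI allI)
        fix x h assume "x \<in> I"
        have "norm ((\<Sum>i<n. h *\<^sub>R f' i x) - h *\<^sub>R (A * bexp (x *\<^sub>R A)))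
            = \<bar>h\<bar> * norm ((\<Sum>i<n. f' i x) - A * bexp (x *\<^sub>R A))"
          unfolding scaleR_sum_right[symmetric] scaleR_diff_right[symmetric] norm_scaleR ..
        also have "\<dots> \<le> \<bar>h\<bar> * e"
          using elim \<open>x \<in> I\<close> by (intro mult_left_mono) (auto intro: less_imp_le)
        finally show "norm ((\<Sum>i<n. h *\<^sub>R f' i x) - h *\<^sub>R (A * bexp (x *\<^sub>R A))) \<le> e * norm h"
          by (simp add: mult.commute)
      qed
    qed
  qed (simp add: I_def)
  then obtain g where g: "\<And>x. x \<in> I \<Longrightarrow> (\<lambda>n. f n x) sums g x"
      "(g has_vector_derivative (A * bexp (t *\<^sub>R A))) (at t within I)"
    using tI by (auto simp: has_vector_derivative_def)
  have "((\<lambda>t. bexp (t *\<^sub>R A)) has_vector_derivative A * bexp (t *\<^sub>R A)) (at t within I)"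
    by (rule has_vector_derivative_transform[OF tI _ g(2)]) (rule sums_unique2[OF sm g(1)])
  moreover have "at t within I = at t"
    using tI by (intro at_within_open) (simp_all add: I_def)
  ultimately show ?thesis
    by (simp add: has_vector_derivative_at_within)
qed

text \<open>
  The product is constant in \<open>s\<close>, because its derivative vanishes. Invertibility of the
  exponential is what turns statements about the transformed flow below into statements about the flow.
\<close>

lemma bexp_minus_right: "bexp (s *\<^sub>R A) * bexp (- s *\<^sub>R A) = 1"
  for A :: "'a::{real_normed_algebra, real_algebra_1, banach}"
proof -
  have d: "((\<lambda>s. bexp (s *\<^sub>R A) * bexp (s *\<^sub>R (- A))) has_vector_derivative 0) (at x within UNIV)" for x
  proof -
    have "((\<lambda>s. bexp (s *\<^sub>R A) * bexp (s *\<^sub>R (- A))) has_vector_derivative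
            bexp (x *\<^sub>R A) * (- A * bexp (x *\<^sub>R (- A))) + A * bexp (x *\<^sub>R A) * bexp (x *\<^sub>R (- A))) (at x)"
      by (intro has_vector_derivative_mult bexp_has_vector_derivative)
    moreover have "bexp (x *\<^sub>R A) * A = A * bexp (x *\<^sub>R A)"
      by (rule bexp_commute) simp
    ultimately show ?thesis by (simp add: mult.assoc[symmetric])
  qed
  obtain c where "\<And>s. bexp (s *\<^sub>R A) * bexp (s *\<^sub>R (- A)) = c"
    using has_vector_derivative_zero_constant[OF convex_UNIV d] by auto
  from this[of s] this[of 0] show ?thesis by simp
qed

section \<open>Newton's backward interpolation formula\<close>

text \<open>
  With \<open>E\<close> the backward shift, this is \<open>(1 - (1 - E))\<^sup>i = E\<^sup>i\<close> expanded twice by the binomial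
  theorem: it says that Newton's backward interpolant takes the prescribed values at its nodes.
\<close>

lemma binomial_inversion_sum:
  fixes a :: "nat \<Rightarrow> real"
  assumes "i < p"
  shows "(\<Sum>m<p. (-1) ^ m * real (i choose m) * (\<Sum>l\<le>m. (-1) ^ l * real (m choose l) * a l)) = a i"
proof -
  \<comment> \<open>By trinomial revision this is an alternating row sum of Pascal's triangle.\<close>
  have inner: "(\<Sum>m=l..i. (-1) ^ m * (-1) ^ l * real (i choose m) * real (m choose l))
      = (if l = i then 1 else 0)" if "l \<le> i" for l
  proof -
    have "(\<Sum>m=l..i. (-1) ^ m * (-1) ^ l * real (i choose m) * real (m choose l))
        = (\<Sum>m=0..i-l. (-1) ^ (m + l) * (-1) ^ l * real (i choose (m + l)) * real ((m + l) choose l))"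
      using that sum.shift_bounds_cl_nat_ivl
        [of "\<lambda>m. (-1) ^ m * (-1) ^ l * real (i choose m) * real (m choose l)" 0 l "i - l"] by simp
    also have "\<dots> = (\<Sum>m\<le>i-l. real (i choose l) * ((-1) ^ m * real ((i - l) choose m)))"
      unfolding atLeast0AtMost
    proof (rule sum.cong)
      fix m assume "m \<in> {..i - l}"
      then have "(i choose (m + l)) * ((m + l) choose l) = (i choose l) * ((i - l) choose m)"
        using that choose_mult[of l "m + l" i] by simp
      then have "real (i choose (m + l)) * real ((m + l) choose l)
          = real (i choose l) * real ((i - l) choose m)"
        by (metis of_nat_mult)
      moreover have "(-1) ^ (m + l) * (-1) ^ l = ((-1) ^ m :: real)"
        by (simp add: power_add mult.assoc flip: power_mult_distrib)
      ultimately show "(-1) ^ (m + l) * (-1) ^ l * real (i choose (m + l)) * real ((m + l) choose l)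
          = real (i choose l) * ((-1) ^ m * real ((i - l) choose m))"
        by (metis mult.assoc mult.left_commute)
    qed simp
    also have "\<dots> = real (i choose l) * (\<Sum>m\<le>i-l. (-1) ^ m * real ((i - l) choose m))"
      by (simp add: sum_distrib_left)
    also have "\<dots> = (if l = i then 1 else 0)"
      using that choose_alternating_sum[of "i - l", where 'a = real] by auto
    finally show ?thesis .
  qed
  have "(\<Sum>m<p. (-1) ^ m * real (i choose m) * (\<Sum>l\<le>m. (-1) ^ l * real (m choose l) * a l))
      = (\<Sum>m\<le>i. (-1) ^ m * real (i choose m) * (\<Sum>l\<le>m. (-1) ^ l * real (m choose l) * a l))"
    using assms by (intro sum.mono_neutral_right) auto
  also have "\<dots> = (\<Sum>m\<le>i. \<Sum>l\<le>m. (-1) ^ m * (-1) ^ l * real (i choose m) * real (m choose l) * a l)"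
    by (simp add: sum_distrib_left mult_ac)
  also have "\<dots> = (\<Sum>m\<le>i. \<Sum>l\<le>i. (-1) ^ m * (-1) ^ l * real (i choose m) * real (m choose l) * a l)"
    by (intro sum.cong sum.mono_neutral_left) auto
  also have "\<dots> = (\<Sum>l\<le>i. \<Sum>m\<le>i. (-1) ^ m * (-1) ^ l * real (i choose m) * real (m choose l) * a l)"
    by (rule sum.swap)
  also have "\<dots> = (\<Sum>l\<le>i. \<Sum>m=l..i. (-1) ^ m * (-1) ^ l * real (i choose m) * real (m choose l) * a l)"
    by (intro sum.cong sum.mono_neutral_right) auto
  also have "\<dots> = (\<Sum>l\<le>i. (if l = i then 1 else 0) * a l)"
    by (intro sum.cong refl) (simp add: inner flip: sum_distrib_right)
  also have "\<dots> = a i"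
    by (simp add: if_distrib[of "\<lambda>x. x * _"] cong: if_cong)
  finally show ?thesis .
qed

text \<open>
  The weight of the \<open>m\<close>-th backward difference in Newton's interpolation formula, namely the
  binomial coefficient of \<open>\<theta> + m - 1\<close> over \<open>m\<close>; \<open>\<theta>\<close> counts steps forward from the last node.
\<close>

definition newton_weight :: "nat \<Rightarrow> real \<Rightarrow> real" where
  "newton_weight m \<theta> = (-1) ^ m * ((- \<theta>) gchoose m)"

lemma abs_newton_weight_le_1:
  assumes "\<theta> \<in> {0..1}"
  shows "\<bar>newton_weight m \<theta>\<bar> \<le> 1"
proof -
  have "\<bar>newton_weight m \<theta>\<bar> = (\<Prod>i = 0..<m. \<bar>- \<theta> - real i\<bar>) / fact m"
    by (simp add: newton_weight_def gbinomial_prod_rev abs_mult abs_prod power_abs)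
  also have "\<dots> \<le> (\<Prod>i = 0..<m. real (Suc i)) / fact m"
    using assms by (intro divide_right_mono prod_mono) auto
  also have "\<dots> = 1"
    by (simp add: fact_prod_Suc)
  finally show ?thesis .
qed

text \<open>
  Newton's formula reproduces polynomials of degree below \<open>p\<close>: both sides are such polynomials
  in \<open>\<theta>\<close>, and by binomial inversion they agree at the \<open>p\<close> nodes \<open>0, -1, \<dots>, -(p - 1)\<close>.
\<close>

lemma newton_backward_poly:
  assumes "degree q < p"
  shows "poly q \<theta> = (\<Sum>m<p. newton_weight m \<theta> *
           (\<Sum>l\<le>m. (-1) ^ l * real (m choose l) * poly q (- real l)))"
proof -
  define D where "D m = (\<Sum>l\<le>m. (-1) ^ l * real (m choose l) * poly q (- real l))" for m
  define r where "r = (\<Sum>m<p. smult (D m * (-1) ^ m) (alpha_poly m 0))"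
  have "q = r"
  proof (rule poly_eqI_degree)
    show "card ((\<lambda>i. - real i) ` {..<p}) > degree q"
      using assms by (subst card_image) (auto simp: inj_on_def)
    have "degree r \<le> p - 1"
      unfolding r_def
      by (intro degree_sum_le order_trans[OF degree_smult_le]) (auto simp: degree_alpha_poly)
    then show "card ((\<lambda>i. - real i) ` {..<p}) > degree r"
      using assms by (subst card_image) (auto simp: inj_on_def)
    fix x assume "x \<in> (\<lambda>i. - real i) ` {..<p}"
    then obtain i where i: "i < p" "x = - real i" by auto
    have "poly r x = (\<Sum>m<p. (-1) ^ m * real (i choose m) * D m)"
      by (simp add: r_def i poly_sum poly_alpha_poly binomial_gbinomial mult_ac)
    also have "\<dots> = poly q x"
      unfolding D_def i(2) by (rule binomial_inversion_sum[OF i(1)])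
    finally show "poly q x = poly r x" by simp
  qed
  then have "poly q \<theta> = poly r \<theta>" by simp
  then show ?thesis
    by (simp add: r_def D_def poly_sum newton_weight_def poly_alpha_poly mult_ac)
qed

text \<open>
  Newton's formula is exact with \<open>m\<close> as well as with \<open>m + 1\<close> terms, so the last term of the longer
  sum vanishes; its weight at \<open>\<theta> = 1\<close> is \<open>1\<close>.
\<close>

lemma backward_diff_poly_eq_0:
  assumes "degree q < m"
  shows "(\<Sum>l\<le>m. (-1) ^ l * real (m choose l) * poly q (- real l)) = 0"
proof -
  have "newton_weight m 1 = 1"
    by (simp add: newton_weight_def gbinomial_minus flip: power_mult_distrib binomial_gbinomial)
  then show ?thesis
    using newton_backward_poly[OF assms, of 1] newton_backward_poly[of q "Suc m" 1] assms by simp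
qed

lemma norm_alternating_sum_le:
  assumes "\<And>l. l \<le> m \<Longrightarrow> norm (r l) \<le> \<epsilon>"
  shows "norm (\<Sum>l\<le>m. ((-1) ^ l * real (m choose l)) *\<^sub>R r l) \<le> 2 ^ m * \<epsilon>"
proof -
  have "norm (\<Sum>l\<le>m. ((-1) ^ l * real (m choose l)) *\<^sub>R r l) \<le> (\<Sum>l\<le>m. real (m choose l) * \<epsilon>)"
    using assms by (intro sum_norm_le) (auto simp: abs_mult power_abs intro!: mult_left_mono)
  also have "\<dots> = 2 ^ m * \<epsilon>"
    by (simp add: choose_row_sum flip: sum_distrib_right of_nat_sum)
  finally show ?thesis .
qed

text \<open>
  Interpolation is linear and exact on polynomials, so it only sees the deviation of \<open>F\<close> from a
  polynomial with coefficients \<open>c k\<close> in the vector space. The constant is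
  \<open>1 + (\<Sum>m<p. 2 ^ m) = 2 ^ p\<close>, as each weight is at most \<open>1\<close> on the unit interval.
\<close>

lemma newton_backward_error:
  fixes F :: "real \<Rightarrow> 'a::real_normed_vector"
  assumes deg: "\<And>k. k < p \<Longrightarrow> degree (q k) < p" and \<theta>: "\<theta> \<in> {0..1}"
    and r: "\<And>x. x \<in> insert \<theta> ((\<lambda>l. - real l) ` {..<p}) \<Longrightarrow>
              norm (F x - (\<Sum>k<p. poly (q k) x *\<^sub>R c k)) \<le> \<epsilon>"
  shows "norm (F \<theta> - (\<Sum>m<p. newton_weight m \<theta> *\<^sub>R
            (\<Sum>l\<le>m. ((-1) ^ l * real (m choose l)) *\<^sub>R F (- real l)))) \<le> 2 ^ p * \<epsilon>"
proof -
  define P where "P x = (\<Sum>k<p. poly (q k) x *\<^sub>R c k)" for x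
  define \<Delta> where "\<Delta> G m = (\<Sum>l\<le>m. ((-1) ^ l * real (m choose l)) *\<^sub>R G (- real l))"
    for m and G :: "real \<Rightarrow> 'a"
  define D where "D k m = (\<Sum>l\<le>m. (-1) ^ l * real (m choose l) * poly (q k) (- real l))" for k m
  have \<Delta>_P: "\<Delta> P m = (\<Sum>k<p. D k m *\<^sub>R c k)" for m
    unfolding \<Delta>_def P_def D_def
    by (simp add: scaleR_sum_right scaleR_sum_left sum.swap[of _ "{..m}"])
  have "P \<theta> = (\<Sum>k<p. (\<Sum>m<p. newton_weight m \<theta> * D k m) *\<^sub>R c k)"
    unfolding P_def D_def
    by (intro sum.cong refl arg_cong2[where f = scaleR] newton_backward_poly deg) simp
  also have "\<dots> = (\<Sum>k<p. \<Sum>m<p. (newton_weight m \<theta> * D k m) *\<^sub>R c k)"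
    by (simp add: scaleR_sum_left)
  also have "\<dots> = (\<Sum>m<p. \<Sum>k<p. (newton_weight m \<theta> * D k m) *\<^sub>R c k)"
    by (rule sum.swap)
  also have "\<dots> = (\<Sum>m<p. newton_weight m \<theta> *\<^sub>R \<Delta> P m)"
    by (simp add: \<Delta>_P scaleR_sum_right)
  finally have P: "P \<theta> = (\<Sum>m<p. newton_weight m \<theta> *\<^sub>R \<Delta> P m)" .
  have \<Delta>_diff: "\<Delta> F m - \<Delta> P m = \<Delta> (\<lambda>x. F x - P x) m" for m
    by (simp add: \<Delta>_def sum_subtractf scaleR_diff_right)
  have "F \<theta> - (\<Sum>m<p. newton_weight m \<theta> *\<^sub>R \<Delta> F m)
      = (F \<theta> - P \<theta>) - (\<Sum>m<p. newton_weight m \<theta> *\<^sub>R \<Delta> (\<lambda>x. F x - P x) m)"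
    unfolding \<Delta>_diff[symmetric] by (simp add: P scaleR_diff_right sum_subtractf)
  also have "norm \<dots> \<le> \<epsilon> + (\<Sum>m<p. 2 ^ m * \<epsilon>)"
  proof (rule order_trans[OF norm_triangle_ineq4], rule add_mono, goal_cases)
    case 1
    show ?case
      using r[of \<theta>] by (simp add: P_def)
  next
    case 2
    show ?case
    proof (rule sum_norm_le)
      fix m assume m: "m \<in> {..<p}"
      have "norm (\<Delta> (\<lambda>x. F x - P x) m) \<le> 2 ^ m * \<epsilon>"
        unfolding \<Delta>_def using m by (intro norm_alternating_sum_le) (auto simp: P_def intro!: r)
      moreover have "\<bar>newton_weight m \<theta>\<bar> * norm (\<Delta> (\<lambda>x. F x - P x) m) \<le> 1 * norm (\<Delta> (\<lambda>x. F x - P x) m)"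
        by (intro mult_right_mono abs_newton_weight_le_1 \<theta>) simp
      ultimately show "norm (newton_weight m \<theta> *\<^sub>R \<Delta> (\<lambda>x. F x - P x) m) \<le> 2 ^ m * \<epsilon>"
        by simp
    qed
  qed
  also have "\<dots> = 2 ^ p * \<epsilon>"
    by (induction p) (simp_all add: algebra_simps)
  finally show ?thesis
    by (simp add: \<Delta>_def)
qed

lemma norm_backward_difference_le:
  fixes F :: "real \<Rightarrow> 'a::real_normed_vector"
  assumes deg: "\<And>k. k < m \<Longrightarrow> degree (q k) < m"
    and r: "\<And>l. l \<le> m \<Longrightarrow> norm (F (- real l) - (\<Sum>k<m. poly (q k) (- real l) *\<^sub>R c k)) \<le> \<epsilon>"
  shows "norm (\<Sum>l\<le>m. ((-1) ^ l * real (m choose l)) *\<^sub>R F (- real l)) \<le> 2 ^ m * \<epsilon>"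
proof -
  define P where "P x = (\<Sum>k<m. poly (q k) x *\<^sub>R c k)" for x
  have "(\<Sum>l\<le>m. ((-1) ^ l * real (m choose l)) *\<^sub>R P (- real l))
      = (\<Sum>k<m. (\<Sum>l\<le>m. (-1) ^ l * real (m choose l) * poly (q k) (- real l)) *\<^sub>R c k)"
    unfolding P_def by (simp add: scaleR_sum_right scaleR_sum_left sum.swap[of _ "{..m}"])
  also have "\<dots> = 0"
    by (simp add: backward_diff_poly_eq_0 deg)
  finally have "(\<Sum>l\<le>m. ((-1) ^ l * real (m choose l)) *\<^sub>R F (- real l))
      = (\<Sum>l\<le>m. ((-1) ^ l * real (m choose l)) *\<^sub>R (F (- real l) - P (- real l)))"
    by (simp add: scaleR_diff_right sum_subtractf)
  then show ?thesis
    using norm_alternating_sum_le[of m "\<lambda>l. F (- real l) - P (- real l)" \<epsilon>] r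
    by (simp add: P_def)
qed

section \<open>Taylor expansion of the stencil values\<close>

lemma taylor_remainder_le:
  fixes D :: "nat \<Rightarrow> real \<Rightarrow> 'a::banach"
  assumes "a \<le> b"
    and D: "\<And>i t. i < k \<Longrightarrow> t \<in> {a..b} \<Longrightarrow>
              (D i has_vector_derivative D (Suc i) t) (at t within {a..b})"
    and B: "\<And>t. t \<in> {a..b} \<Longrightarrow> norm (D k t) \<le> B"
  shows "norm (D 0 b - (\<Sum>i<k. ((b - a) ^ i / fact i) *\<^sub>R D i a)) \<le> B * (b - a) ^ k"
proof (cases "k = 0")
  case True
  then show ?thesis using B[of b] \<open>a \<le> b\<close> by simp
next
  case False
  have "0 \<le> B"
    using B[of a] \<open>a \<le> b\<close> norm_ge_zero[of "D k a"] by (simp del: norm_ge_zero)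
  have "((\<lambda>x. ((b - x) ^ (k - 1) / fact (k - 1)) *\<^sub>R D k x) has_integral
      D 0 b - (\<Sum>i<k. ((b - a) ^ i / fact i) *\<^sub>R D i a)) {a..b}"
    using False D \<open>a \<le> b\<close> by (intro Taylor_has_integral) auto
  then have "norm (D 0 b - (\<Sum>i<k. ((b - a) ^ i / fact i) *\<^sub>R D i a))
      \<le> ((b - a) ^ (k - 1) * B) * measure lborel {a..b}"
  proof (rule has_integral_bound_real[where S = "{}", rotated 2])
    show "0 \<le> (b - a) ^ (k - 1) * B" using \<open>0 \<le> B\<close> \<open>a \<le> b\<close> by simp
    show "norm (((b - x) ^ (k - 1) / fact (k - 1)) *\<^sub>R D k x) \<le> (b - a) ^ (k - 1) * B"
      if "x \<in> {a..b} - {}" for x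
    proof -
      from that have x: "x \<in> {a..b}" by simp
      have "(b - x) ^ (k - 1) / fact (k - 1) \<le> (b - x) ^ (k - 1) / 1"
        using x by (intro divide_left_mono) auto
      also have "\<dots> \<le> (b - a) ^ (k - 1)"
        using x by (simp add: power_mono)
      finally show ?thesis
        unfolding norm_scaleR using x B[of x] \<open>a \<le> b\<close> by (intro mult_mono) auto
    qed
  qed simp
  also have "\<dots> = B * (b - a) ^ k"
    using False \<open>a \<le> b\<close> by (cases k) simp_all
  finally show ?thesis .
qed

text \<open>
  The \<open>k\<close>-th Taylor monomial, with expansion point \<open>r\<close> steps of length \<open>h\<close> in the past, as a
  polynomial in the number of steps.
\<close>

definition taylor_poly :: "real \<Rightarrow> real \<Rightarrow> nat \<Rightarrow> real poly" where
  "taylor_poly r h k = smult (h ^ k / fact k) ([:r, 1:] ^ k)"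

lemma degree_taylor_poly: "degree (taylor_poly r h k) \<le> k"
  unfolding taylor_poly_def
  by (intro order_trans[OF degree_smult_le] order_trans[OF degree_power_le]) simp

lemma poly_taylor_poly: "poly (taylor_poly r h k) x = ((x + r) * h) ^ k / fact k"
  by (simp add: taylor_poly_def poly_power power_mult_distrib add.commute)

text \<open>
  The derivatives form a given family \<open>D\<close> instead of being values of a derivative operator, so that
  they stay the same when the interval is restricted to a stencil. One \<open>B\<close> serves all orders, as the
  \<open>m\<close>-th backward differences use the order \<open>m\<close> and the interpolation error the order \<open>p\<close>.
\<close>

locale bounded_derivatives =
  fixes D :: "nat \<Rightarrow> real \<Rightarrow> 'a::banach" and T B :: real and p :: nat
  assumes D: "\<And>i t. i < p \<Longrightarrow> t \<in> {0..T} \<Longrightarrow>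
              (D i has_vector_derivative D (Suc i) t) (at t within {0..T})"
    and D_bound: "\<And>i t. i \<le> p \<Longrightarrow> t \<in> {0..T} \<Longrightarrow> norm (D i t) \<le> B"
    and B_nonneg: "0 \<le> B"
begin

text \<open>
  In both uses below the expansion point \<open>t - r h\<close> is the oldest node of the stencil, so that all
  evaluation points lie to its right and one-sided Taylor expansion covers them at once.
\<close>

lemma taylor_on_grid:
  assumes "k \<le> p" "0 \<le> h" "0 \<le> t - r * h" "t + x * h \<le> T" "- r \<le> x"
  shows "norm (D 0 (t + x * h) - (\<Sum>i<k. poly (taylor_poly r h i) x *\<^sub>R D i (t - r * h)))
           \<le> B * ((x + r) * h) ^ k"
proof -
  have ab: "t - r * h \<le> t + x * h"
    using assms mult_right_mono[of "- r" x h] by simp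
  have eq: "t + x * h - (t - r * h) = (x + r) * h"
    by (simp add: algebra_simps)
  have "norm (D 0 (t + x * h) - (\<Sum>i<k. ((t + x * h - (t - r * h)) ^ i / fact i) *\<^sub>R D i (t - r * h)))
      \<le> B * (t + x * h - (t - r * h)) ^ k"
    using assms ab
    by (intro taylor_remainder_le has_vector_derivative_within_subset[OF D] D_bound) auto
  then show ?thesis
    unfolding eq by (simp add: poly_taylor_poly)
qed

lemma norm_backward_difference_le_power:
  assumes "m \<le> p" "0 \<le> h" "0 \<le> t - real m * h" "t \<le> T"
  shows "norm (\<Sum>l\<le>m. ((-1) ^ l * real (m choose l)) *\<^sub>R D 0 (t + (- real l) * h))
           \<le> 2 ^ m * (B * (real m * h) ^ m)"
proof (rule norm_backward_difference_le[where F = "\<lambda>x. D 0 (t + x * h)"])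
  show "degree (taylor_poly (real m) h k) < m" if "k < m" for k
    using degree_taylor_poly that by (rule order.strict_trans1)
  fix l assume l: "l \<le> m"
  have "norm (D 0 (t + - real l * h) - (\<Sum>i<m. poly (taylor_poly (real m) h i) (- real l) *\<^sub>R D i (t - real m * h)))
           \<le> B * ((- real l + real m) * h) ^ m"
    using assms l mult_nonneg_nonneg[of "real l" h] by (intro taylor_on_grid) (auto intro: order_trans[of _ t])
  also have "\<dots> \<le> B * (real m * h) ^ m"
    using l assms B_nonneg by (intro mult_left_mono power_mono mult_right_mono) auto
  finally show "norm (D 0 (t + - real l * h) - (\<Sum>i<m. poly (taylor_poly (real m) h i) (- real l) *\<^sub>R D i (t - real m * h)))
           \<le> B * (real m * h) ^ m" .
qed

lemma newton_backward_error_power: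
  assumes "1 \<le> p" "0 \<le> h" "0 \<le> t - (real p - 1) * h" "t + h \<le> T" "\<theta> \<in> {0..1}"
  shows "norm (D 0 (t + \<theta> * h) - (\<Sum>m<p. newton_weight m \<theta> *\<^sub>R
            (\<Sum>l\<le>m. ((-1) ^ l * real (m choose l)) *\<^sub>R D 0 (t + (- real l) * h))))
           \<le> 2 ^ p * (B * (real p * h) ^ p)"
proof (rule newton_backward_error[where F = "\<lambda>x. D 0 (t + x * h)"])
  show "degree (taylor_poly (real p - 1) h k) < p" if "k < p" for k
    using degree_taylor_poly that by (rule order.strict_trans1)
  fix x assume "x \<in> insert \<theta> ((\<lambda>l. - real l) ` {..<p})"
  then have x: "- (real p - 1) \<le> x" "x \<le> 1"
    using assms by auto
  then have "x * h \<le> 1 * h"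
    using assms by (intro mult_right_mono) auto
  then have "norm (D 0 (t + x * h) - (\<Sum>i<p. poly (taylor_poly (real p - 1) h i) x *\<^sub>R D i (t - (real p - 1) * h)))
           \<le> B * ((x + (real p - 1)) * h) ^ p"
    using assms x by (intro taylor_on_grid) auto
  also have "\<dots> \<le> B * (real p * h) ^ p"
    using x assms B_nonneg by (intro mult_left_mono power_mono mult_right_mono) auto
  finally show "norm (D 0 (t + x * h) - (\<Sum>i<p. poly (taylor_poly (real p - 1) h i) x *\<^sub>R D i (t - (real p - 1) * h)))
           \<le> B * (real p * h) ^ p" .
qed (use assms in auto)

end

lemma bounded_derivatives_Ck_on:
  fixes f :: "real \<Rightarrow> 'a::banach"
  assumes "Ck_on p f {0..T}"
    and bdd: "\<And>k. k \<le> p \<Longrightarrow> bounded (nth_vector_derivative k f {0..T} ` {0..T})"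
  obtains B where "bounded_derivatives (\<lambda>k. nth_vector_derivative k f {0..T}) T B p"
proof -
  have "bounded (\<Union>k\<in>{..p}. nth_vector_derivative k f {0..T} ` {0..T})"
    using bdd by (intro bounded_UN) auto
  then obtain B where B: "0 < B"
      "\<And>x. x \<in> (\<Union>k\<in>{..p}. nth_vector_derivative k f {0..T} ` {0..T}) \<Longrightarrow> norm x \<le> B"
    by (auto simp: bounded_pos)
  show thesis
  proof (rule that, unfold_locales)
    show "(nth_vector_derivative i f {0..T} has_vector_derivative nth_vector_derivative (Suc i) f {0..T} t)
        (at t within {0..T})" if "i < p" "t \<in> {0..T}" for i t
      using assms(1) that by (auto simp: Ck_on_def vector_derivative_works[symmetric])
    show "norm (nth_vector_derivative i f {0..T} t) \<le> B" if "i \<le> p" "t \<in> {0..T}" for i t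
      using that by (intro B(2) UN_I[of i] imageI) auto
    show "0 \<le> B" using B(1) by simp
  qed
qed

section \<open>Expansion of the two-sided linear flow in commutators\<close>

lemma bounded_linear_ad: "bounded_linear (ad R)"
  unfolding ad_def
  by (intro bounded_linear_sub bounded_linear_mult_left bounded_linear_mult_right)

lemma norm_ad_le: "norm (ad R X) \<le> 2 * norm R * norm X"
  for R X :: "'a::{real_normed_algebra, real_algebra_1, banach}"
proof -
  have "norm (ad R X) \<le> norm (X * R) + norm (R * X)"
    unfolding ad_def by (rule norm_triangle_ineq4)
  also have "\<dots> \<le> norm X * norm R + norm R * norm X"
    by (intro add_mono norm_mult_ineq)
  finally show ?thesis by simp
qed

lemma norm_ad_funpow_le: "norm ((ad R ^^ k) X) \<le> (2 * norm R) ^ k * norm X"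
  for R X :: "'a::{real_normed_algebra, real_algebra_1, banach}"
proof (induction k)
  case (Suc k)
  have "norm ((ad R ^^ Suc k) X) \<le> 2 * norm R * norm ((ad R ^^ k) X)"
    by (simp add: norm_ad_le)
  also have "\<dots> \<le> 2 * norm R * ((2 * norm R) ^ k * norm X)"
    by (intro mult_left_mono Suc) simp
  finally show ?case by (simp add: mult_ac)
qed simp

lemma bounded_linear_ad_funpow:
  "bounded_linear (ad R ^^ k :: 'a \<Rightarrow> 'a::{real_normed_algebra, real_algebra_1, banach})"
  by (induction k)
     (simp_all add: bounded_linear_ident id_def bounded_linear_compose[OF bounded_linear_ad] o_def)

lemma norm_mult3_le:
  fixes a b c :: "'a::real_normed_algebra"
  assumes "norm a \<le> \<alpha>" "norm b \<le> \<beta>" "norm c \<le> \<gamma>"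
  shows "norm (a * b * c) \<le> \<alpha> * \<beta> * \<gamma>"
proof -
  have "0 \<le> \<alpha>" "0 \<le> \<beta>" using assms norm_ge_zero order_trans by blast+
  then show ?thesis
    using assms
    by (intro order_trans[OF norm_mult_ineq] mult_mono order_trans[OF norm_mult_ineq]) auto
qed

lemma norm_bexp_scaleR_le:
  fixes A :: "'a::{real_normed_algebra, real_algebra_1, banach}"
  assumes "\<bar>s\<bar> \<le> T"
  shows "norm (bexp (s *\<^sub>R A)) \<le> norm (1::'a) * exp (T * norm A)"
  using assms
  by (intro order_trans[OF norm_bexp_le] mult_left_mono) (auto intro!: mult_right_mono)

text \<open>
  Transforming the flow of \<open>X \<mapsto> L X + X R\<close> by \<open>bexp (- s (L + R))\<close> from the left removes
  all of its generator but the commutator with \<open>R\<close>: the commuting pair \<open>L\<close>, \<open>R\<close> also commutes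
  with that exponential, and what remains is \<open>X R - R X\<close>.
\<close>

lemma bexp_conjugation_has_vector_derivative:
  fixes L R X :: "'a::{real_normed_algebra, real_algebra_1, banach}"
  assumes comm: "L * R = R * L"
  defines "u \<equiv> \<lambda>s. bexp (- s *\<^sub>R (L + R)) * (bexp (s *\<^sub>R L) * X * bexp (s *\<^sub>R R))"
  shows "(u has_vector_derivative ad R (u s)) (at s within S)"
proof -
  define M E W where "M = L + R" and "E = bexp (s *\<^sub>R (- M))"
    and "W = bexp (s *\<^sub>R L) * X * bexp (s *\<^sub>R R)"
  have R: "R * E = E * R" "M * E = E * M"
    unfolding E_def
    by (rule bexp_commute[symmetric], simp add: M_def algebra_simps comm)+
  have "bexp (s *\<^sub>R R) * R = R * bexp (s *\<^sub>R R)"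
    by (rule bexp_commute) simp
  then have W: "bexp (s *\<^sub>R L) * X * (R * bexp (s *\<^sub>R R)) + L * bexp (s *\<^sub>R L) * X * bexp (s *\<^sub>R R)
      = W * R + L * W"
    by (simp add: W_def mult.assoc)
  have "((\<lambda>s. bexp (s *\<^sub>R L) * X * bexp (s *\<^sub>R R)) has_vector_derivative
      bexp (s *\<^sub>R L) * X * (R * bexp (s *\<^sub>R R))
        + L * bexp (s *\<^sub>R L) * X * bexp (s *\<^sub>R R)) (at s within S)"
    by (intro has_vector_derivative_mult bexp_has_vector_derivative
          bounded_linear.has_vector_derivative[OF bounded_linear_mult_left])
  then have "((\<lambda>s. bexp (s *\<^sub>R L) * X * bexp (s *\<^sub>R R)) has_vector_derivative W * R + L * W)
      (at s within S)"
    unfolding W .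
  then have "((\<lambda>s. bexp (s *\<^sub>R (- M)) * (bexp (s *\<^sub>R L) * X * bexp (s *\<^sub>R R)))
      has_vector_derivative E * (W * R + L * W) + (- M * E) * W) (at s within S)"
    unfolding E_def W_def by (intro has_vector_derivative_mult bexp_has_vector_derivative)
  moreover have "E * (W * R + L * W) + (- M * E) * W = (E * W) * R - R * (E * W)"
  proof -
    have "(- M * E) * W = - (E * (M * W))" by (simp add: R mult.assoc)
    moreover have "R * (E * W) = E * (R * W)" by (metis R(1) mult.assoc)
    ultimately show ?thesis by (simp add: M_def algebra_simps)
  qed
  moreover have "(\<lambda>s. bexp (s *\<^sub>R (- M)) * (bexp (s *\<^sub>R L) * X * bexp (s *\<^sub>R R))) = u"
    by (simp add: u_def flip: M_def)
  moreover have "E * W = u s"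
    by (simp add: u_def E_def W_def flip: M_def)
  ultimately show ?thesis by (simp add: ad_def)
qed

text \<open>
  The transformed flow \<open>u\<close> solves \<open>u' = ad R u\<close>, so \<open>(ad R ^^ j) (u s)\<close> is its \<open>j\<close>-th derivative
  and Taylor's theorem at \<open>0\<close> gives the sum over \<open>j\<close>. This is where the commutators of the
  scheme come from. The constant must not depend on \<open>s\<close> and \<open>X\<close>, since the lemma is applied to
  backward differences that are themselves small.
\<close>

lemma bexp_sandwich_expansion:
  fixes L R :: "'a::{real_normed_algebra, real_algebra_1, banach}"
  assumes comm: "L * R = R * L" and "0 \<le> T"
  obtains C where "0 \<le> C"
    and "\<And>s X. s \<in> {0..T} \<Longrightarrow>
      norm (bexp (s *\<^sub>R L) * X * bexp (s *\<^sub>R R)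
          - bexp (s *\<^sub>R (L + R)) * (\<Sum>j<k. (s ^ j / fact j) *\<^sub>R (ad R ^^ j) X)) \<le> C * s ^ k * norm X"
proof -
  define e where "e A = norm (1::'a) * exp (T * norm A)" for A :: 'a
  have e: "norm (bexp (s *\<^sub>R A)) \<le> e A" if "\<bar>s\<bar> \<le> T" for s A
    unfolding e_def by (rule norm_bexp_scaleR_le[OF that])
  have e_pos: "0 \<le> e A" for A by (simp add: e_def)
  define M where "M = L + R"
  define c where "c = (2 * norm R) ^ k * (e (- M) * (e L * e R))"
  have "norm (bexp (s *\<^sub>R L) * X * bexp (s *\<^sub>R R)
          - bexp (s *\<^sub>R (L + R)) * (\<Sum>j<k. (s ^ j / fact j) *\<^sub>R (ad R ^^ j) X)) \<le> e M * c * s ^ k * norm X"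
    if s: "s \<in> {0..T}" for s X
  proof -
    define u where "u = (\<lambda>s. bexp (- s *\<^sub>R (L + R)) * (bexp (s *\<^sub>R L) * X * bexp (s *\<^sub>R R)))"
    have u0: "u 0 = X" by (simp add: u_def)
    have "norm ((ad R ^^ 0) (u s) - (\<Sum>j<k. ((s - 0) ^ j / fact j) *\<^sub>R (ad R ^^ j) (u 0)))
        \<le> (c * norm X) * (s - 0) ^ k"
    proof (rule taylor_remainder_le)
      fix i t
      show "((\<lambda>t. (ad R ^^ i) (u t)) has_vector_derivative (ad R ^^ Suc i) (u t)) (at t within {0..s})"
        using bounded_linear.has_vector_derivative[OF bounded_linear_ad_funpow
            bexp_conjugation_has_vector_derivative[OF comm, of X t "{0..s}"], of i R]
        by (simp add: u_def funpow_swap1)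
    next
      fix t assume t: "t \<in> {0..s}"
      have "norm (u t) \<le> e (- M) * (e L * norm X * e R)"
      proof -
        have minus: "t *\<^sub>R (- M) = - t *\<^sub>R (L + R)"
          by (simp add: M_def algebra_simps)
        have "norm (bexp (- t *\<^sub>R (L + R))) \<le> e (- M)"
          using e[of t "- M"] s t unfolding minus by simp
        moreover have "norm (bexp (t *\<^sub>R L) * X * bexp (t *\<^sub>R R)) \<le> e L * norm X * e R"
          using s t by (intro norm_mult3_le e) auto
        ultimately show ?thesis
          unfolding u_def
          by (rule order_trans[OF norm_mult_ineq mult_mono]) (simp_all add: e_pos)
      qed
      then have "norm ((ad R ^^ k) (u t)) \<le> (2 * norm R) ^ k * (e (- M) * (e L * norm X * e R))"
        by (intro order_trans[OF norm_ad_funpow_le] mult_left_mono) auto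
      then show "norm ((ad R ^^ k) (u t)) \<le> c * norm X"
        by (simp add: c_def mult_ac)
    qed (use s in auto)
    then have rem: "norm (u s - (\<Sum>j<k. (s ^ j / fact j) *\<^sub>R (ad R ^^ j) X)) \<le> c * norm X * s ^ k"
      by (simp add: u0)
    have "bexp (s *\<^sub>R L) * X * bexp (s *\<^sub>R R) = bexp (s *\<^sub>R M) * u s"
      using bexp_minus_right[of s M] by (simp add: u_def M_def flip: mult.assoc)
    then have "norm (bexp (s *\<^sub>R L) * X * bexp (s *\<^sub>R R)
          - bexp (s *\<^sub>R (L + R)) * (\<Sum>j<k. (s ^ j / fact j) *\<^sub>R (ad R ^^ j) X))
        = norm (bexp (s *\<^sub>R M) * (u s - (\<Sum>j<k. (s ^ j / fact j) *\<^sub>R (ad R ^^ j) X)))"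
      by (simp add: M_def right_diff_distrib)
    also have "\<dots> \<le> e M * (c * norm X * s ^ k)"
      using s by (intro order_trans[OF norm_mult_ineq] mult_mono e rem) (auto simp: e_pos)
    finally show ?thesis by (simp add: mult_ac)
  qed
  moreover have "0 \<le> e M * c" by (simp add: c_def e_pos)
  ultimately show thesis by (rule that[rotated])
qed

section \<open>The defect as an integral\<close>

lemma continuous_on_bexp_line:
  fixes A :: "'a::{real_normed_algebra, real_algebra_1, banach}"
  shows "continuous_on S (\<lambda>\<theta>. bexp ((1 - \<theta>) *\<^sub>R A))"
proof (rule continuous_on_compose2[where f = "\<lambda>\<theta>. 1 - \<theta>" and t = UNIV and g = "\<lambda>s. bexp (s *\<^sub>R A)"])
  show "continuous_on UNIV (\<lambda>s. bexp (s *\<^sub>R A))"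
    by (rule continuous_on_vector_derivative) (rule bexp_has_vector_derivative)
qed (auto intro!: continuous_intros)

lemma phi_Suc_has_integral:
  fixes A :: "'a::{real_normed_algebra, real_algebra_1, banach}"
  shows "((\<lambda>\<theta>. (\<theta> ^ q / fact q) *\<^sub>R bexp ((1 - \<theta>) *\<^sub>R A)) has_integral phi (q + 1) A) {0..1}"
  unfolding phi_def
  by (simp, intro integrable_integral integrable_continuous_real continuous_intros continuous_on_bexp_line) auto

text \<open>
  The numbers \<open>alpha m j q\<close> are the monomial coefficients of \<open>(1 - \<theta>) ^ j\<close> times a binomial, and
  the factor \<open>q!\<close> cancels the normalisation of \<open>phi\<close>. Hence the coefficients of the scheme are the
  moments of the exponential against that polynomial.
\<close>

lemma metd_coeff_has_integral:
  fixes A :: "'a::{real_normed_algebra, real_algebra_1, banach}"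
  shows "((\<lambda>\<theta>. ((1 - \<theta>) ^ j / fact j * newton_weight m \<theta>) *\<^sub>R bexp ((1 - \<theta>) *\<^sub>R A))
           has_integral metd_coeff m j A) {0..1}"
proof -
  have "((\<lambda>\<theta>. ((-1) ^ m / fact j) *\<^sub>R (\<Sum>q\<le>m + j. (alpha m j q * fact q) *\<^sub>R
            ((\<theta> ^ q / fact q) *\<^sub>R bexp ((1 - \<theta>) *\<^sub>R A)))) has_integral metd_coeff m j A) {0..1}"
    unfolding metd_coeff_def
    by (intro has_integral_cmul has_integral_sum phi_Suc_has_integral) simp
  moreover have "((-1) ^ m / fact j) *\<^sub>R (\<Sum>q\<le>m + j. (alpha m j q * fact q) *\<^sub>R
            ((\<theta> ^ q / fact q) *\<^sub>R bexp ((1 - \<theta>) *\<^sub>R A)))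
      = ((1 - \<theta>) ^ j / fact j * newton_weight m \<theta>) *\<^sub>R bexp ((1 - \<theta>) *\<^sub>R A)" for \<theta>
  proof -
    have "(\<Sum>q\<le>m + j. (alpha m j q * fact q) *\<^sub>R ((\<theta> ^ q / fact q) *\<^sub>R bexp ((1 - \<theta>) *\<^sub>R A)))
        = ((1 - \<theta>) ^ j * ((- \<theta>) gchoose m)) *\<^sub>R bexp ((1 - \<theta>) *\<^sub>R A)"
      by (simp add: alpha_identity scaleR_sum_left)
    then show ?thesis by (simp add: newton_weight_def mult_ac)
  qed
  ultimately show ?thesis by simp
qed

text \<open>
  The increment is the integral in the variation-of-constants formula with two replacements:
  Newton's interpolant for the nonlinearity, and on its \<open>m\<close>-th term the expansion of the flow in
  commutators, cut off after \<open>p - m\<close> terms.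
\<close>

lemma metd_increment_has_integral:
  fixes L R :: "'a::{real_normed_algebra, real_algebra_1, banach}" and X :: "nat \<Rightarrow> 'a"
    and N :: "'a \<Rightarrow> real \<Rightarrow> 'a" and h :: real and n :: nat
  defines "\<Delta> \<equiv> \<lambda>m. backward_diff m (\<lambda>k. N (X k) (real k * h)) n"
  shows "((\<lambda>\<theta>. h *\<^sub>R (\<Sum>m<p. newton_weight m \<theta> *\<^sub>R (bexp (((1 - \<theta>) * h) *\<^sub>R (L + R)) *
            (\<Sum>j<p - m. (((1 - \<theta>) * h) ^ j / fact j) *\<^sub>R (ad R ^^ j) (\<Delta> m)))))
          has_integral metd_increment p L R N h X n) {0..1}"
proof -
  have "((\<lambda>\<theta>. h *\<^sub>R (\<Sum>m\<in>{0..<p}. \<Sum>j\<in>{0..p - 1 - m}. h ^ j *\<^sub>R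
            ((((1 - \<theta>) ^ j / fact j * newton_weight m \<theta>) *\<^sub>R bexp ((1 - \<theta>) *\<^sub>R (h *\<^sub>R (L + R))))
              * (ad R ^^ j) (\<Delta> m))))
          has_integral metd_increment p L R N h X n) {0..1}"
    unfolding metd_increment_def \<Delta>_def
    by (intro has_integral_cmul has_integral_sum has_integral_mult_left metd_coeff_has_integral) simp_all
  moreover have "(\<Sum>m\<in>{0..<p}. \<Sum>j\<in>{0..p - 1 - m}. h ^ j *\<^sub>R
            ((((1 - \<theta>) ^ j / fact j * newton_weight m \<theta>) *\<^sub>R bexp ((1 - \<theta>) *\<^sub>R (h *\<^sub>R (L + R))))
              * (ad R ^^ j) (\<Delta> m)))
      = (\<Sum>m<p. newton_weight m \<theta> *\<^sub>R (bexp (((1 - \<theta>) * h) *\<^sub>R (L + R)) *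
            (\<Sum>j<p - m. (((1 - \<theta>) * h) ^ j / fact j) *\<^sub>R (ad R ^^ j) (\<Delta> m))))" for \<theta>
  proof (rule sum.cong)
    fix m assume "m \<in> {..<p}"
    then have "{0..p - 1 - m} = {..<p - m}" by auto
    then show "(\<Sum>j\<in>{0..p - 1 - m}. h ^ j *\<^sub>R
            ((((1 - \<theta>) ^ j / fact j * newton_weight m \<theta>) *\<^sub>R bexp ((1 - \<theta>) *\<^sub>R (h *\<^sub>R (L + R))))
              * (ad R ^^ j) (\<Delta> m)))
      = newton_weight m \<theta> *\<^sub>R (bexp (((1 - \<theta>) * h) *\<^sub>R (L + R)) *
            (\<Sum>j<p - m. (((1 - \<theta>) * h) ^ j / fact j) *\<^sub>R (ad R ^^ j) (\<Delta> m)))"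
      by (simp add: sum_distrib_left scaleR_sum_right power_mult_distrib mult_ac)
  qed auto
  ultimately show ?thesis by simp
qed

text \<open>
  Transporting \<open>Q\<close> to the end of the step by the linear flow leaves only the inhomogeneity in the
  derivative; the formula is the fundamental theorem of calculus for the transported function.
\<close>

lemma variation_of_constants:
  fixes L R :: "'a::{real_normed_algebra, real_algebra_1, banach}"
  assumes Q: "\<And>t. t \<in> {0..T} \<Longrightarrow>
           (Q has_vector_derivative L * Q t + Q t * R + f t) (at t within {0..T})"
    and "0 \<le> t" "0 \<le> h" "t + h \<le> T"
  shows "((\<lambda>\<theta>. h *\<^sub>R (bexp (((1 - \<theta>) * h) *\<^sub>R L) * f (t + \<theta> * h) * bexp (((1 - \<theta>) * h) *\<^sub>R R)))
           has_integral Q (t + h) - bexp (h *\<^sub>R L) * Q t * bexp (h *\<^sub>R R)) {0..1}"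
proof -
  define G where "G \<theta> = bexp (((1 - \<theta>) * h) *\<^sub>R L) * Q (t + \<theta> * h) * bexp (((1 - \<theta>) * h) *\<^sub>R R)" for \<theta>
  have dG: "(G has_vector_derivative
      h *\<^sub>R (bexp (((1 - \<theta>) * h) *\<^sub>R L) * f (t + \<theta> * h) * bexp (((1 - \<theta>) * h) *\<^sub>R R))) (at \<theta> within {0..1})"
    if \<theta>: "\<theta> \<in> {0..1}" for \<theta>
  proof -
    have rng: "(\<lambda>\<theta>. t + \<theta> * h) ` {0..1} \<subseteq> {0..T}"
    proof safe
      fix x :: real assume "x \<in> {0..1}"
      then have "0 \<le> x * h" "x * h \<le> 1 * h"
        using \<open>0 \<le> h\<close> by (auto simp: mult_le_cancel_right1 intro: mult_left_le_one_le)
      then show "t + x * h \<in> {0..T}" using assms by simp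
    qed
    have e: "((\<lambda>\<theta>. bexp (((1 - \<theta>) * h) *\<^sub>R A)) has_vector_derivative
        - h *\<^sub>R (A * bexp (((1 - \<theta>) * h) *\<^sub>R A))) (at \<theta> within {0..1})" for A :: 'a
    proof -
      have "((\<lambda>\<theta>. (1 - \<theta>) * h) has_vector_derivative - h) (at \<theta> within {0..1})"
        by (auto intro!: derivative_eq_intros simp flip: has_real_derivative_iff_has_vector_derivative)
      from vector_diff_chain_within[OF this bexp_has_vector_derivative[of A]]
      show ?thesis by (simp add: o_def)
    qed
    have q: "((\<lambda>\<theta>. Q (t + \<theta> * h)) has_vector_derivative
        h *\<^sub>R (L * Q (t + \<theta> * h) + Q (t + \<theta> * h) * R + f (t + \<theta> * h))) (at \<theta> within {0..1})"
    proof -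
      have "((\<lambda>\<theta>. t + \<theta> * h) has_vector_derivative h) (at \<theta> within {0..1})"
        by (auto intro!: derivative_eq_intros simp flip: has_real_derivative_iff_has_vector_derivative)
      moreover have "(Q has_vector_derivative L * Q (t + \<theta> * h) + Q (t + \<theta> * h) * R + f (t + \<theta> * h))
          (at (t + \<theta> * h) within (\<lambda>\<theta>. t + \<theta> * h) ` {0..1})"
        by (rule has_vector_derivative_within_subset[OF Q rng]) (use rng \<theta> in blast)
      ultimately show ?thesis
        using vector_diff_chain_within by (fastforce simp: o_def)
    qed
    define EL ER q where "EL = bexp (((1 - \<theta>) * h) *\<^sub>R L)" and "ER = bexp (((1 - \<theta>) * h) *\<^sub>R R)"
      and "q = Q (t + \<theta> * h)"
    have LE: "L * EL = EL * L"
      unfolding EL_def by (rule bexp_commute[symmetric]) simp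
    have "(G has_vector_derivative
        EL * q * (- h *\<^sub>R (R * ER))
          + (EL * (h *\<^sub>R (L * q + q * R + f (t + \<theta> * h))) + (- h *\<^sub>R (L * EL)) * q) * ER)
        (at \<theta> within {0..1})"
      unfolding G_def EL_def ER_def q_def by (intro has_vector_derivative_mult e q)
    moreover have "EL * q * (- h *\<^sub>R (R * ER))
          + (EL * (h *\<^sub>R (L * q + q * R + f (t + \<theta> * h))) + (- h *\<^sub>R (L * EL)) * q) * ER
        = h *\<^sub>R (EL * f (t + \<theta> * h) * ER)"
      unfolding LE by (simp add: algebra_simps)
    ultimately show ?thesis by (simp add: EL_def ER_def)
  qed
  have "((\<lambda>\<theta>. h *\<^sub>R (bexp (((1 - \<theta>) * h) *\<^sub>R L) * f (t + \<theta> * h) * bexp (((1 - \<theta>) * h) *\<^sub>R R)))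
           has_integral G 1 - G 0) {0..1}"
    by (rule fundamental_theorem_of_calculus[OF _ dG]) auto
  then show ?thesis by (simp add: G_def)
qed

text \<open>
  The defect is an integral, over a step of length \<open>h\<close>, of a difference with two sources. The
  interpolation error is \<open>O(h\<^sup>p)\<close>. The expansion of the flow on the \<open>m\<close>-th difference has
  remainder \<open>O(h\<^bsup>p-m\<^esup>)\<close> relative to that difference, which is \<open>O(h\<^sup>m)\<close>: the truncation
  \<open>m + j \<le> p - 1\<close> balances the two orders.
\<close>

lemma metd_defect_le:
  fixes L R :: "'a::{real_normed_algebra, real_algebra_1, banach}"
  assumes "0 \<le> T" "1 \<le> p" and comm: "L * R = R * L"
    and Q: "\<And>t. t \<in> {0..T} \<Longrightarrow>
           (Q has_vector_derivative L * Q t + Q t * R + N (Q t) t) (at t within {0..T})"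
    and bd: "bounded_derivatives D T B p" and D0: "D 0 = (\<lambda>t. N (Q t) t)"
  shows "\<exists>C. \<forall>h n. 0 < h \<longrightarrow> p - 1 \<le> n \<longrightarrow> real (n + 1) * h \<le> T \<longrightarrow>
            norm (metd_defect p L R N Q h n) \<le> C * h ^ (p + 1)"
proof -
  interpret bounded_derivatives D T B p by (rule bd)
  define expansion_const where "expansion_const m c \<longleftrightarrow> 0 \<le> c \<and> (\<forall>s\<in>{0..T}. \<forall>X.
      norm (bexp (s *\<^sub>R L) * X * bexp (s *\<^sub>R R)
          - bexp (s *\<^sub>R (L + R)) * (\<Sum>j<p - m. (s ^ j / fact j) *\<^sub>R (ad R ^^ j) X)) \<le> c * s ^ (p - m) * norm X)"
    for m c
  have "\<exists>c. expansion_const m c" for m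
    unfolding expansion_const_def
    by (rule bexp_sandwich_expansion[OF comm \<open>0 \<le> T\<close>, of "p - m"]) blast
  then obtain C where "\<And>m. expansion_const m (C m)"
    by metis
  then have C_pos: "0 \<le> C m" and C: "s \<in> {0..T} \<Longrightarrow>
      norm (bexp (s *\<^sub>R L) * X * bexp (s *\<^sub>R R)
          - bexp (s *\<^sub>R (L + R)) * (\<Sum>j<p - m. (s ^ j / fact j) *\<^sub>R (ad R ^^ j) X)) \<le> C m * s ^ (p - m) * norm X"
    for m s X
    by (simp_all add: expansion_const_def)
  define e where "e A = norm (1::'a) * exp (T * norm A)" for A :: 'a
  have e: "norm (bexp (s *\<^sub>R A)) \<le> e A" if "\<bar>s\<bar> \<le> T" for s A
    unfolding e_def by (rule norm_bexp_scaleR_le[OF that])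
  \<comment> \<open>First summand: interpolation error carried by the flow; the others: cut-off errors.\<close>
  define K where "K = e L * (2 ^ p * (B * real p ^ p)) * e R
    + (\<Sum>m<p. C m * (2 ^ m * (B * real m ^ m)))"
  have K_nonneg: "0 \<le> K"
    unfolding K_def e_def using C_pos B_nonneg by (intro add_nonneg_nonneg sum_nonneg mult_nonneg_nonneg) auto
  have "norm (metd_defect p L R N Q h n) \<le> K * h ^ (p + 1)"
    if h: "0 < h" and n: "p - 1 \<le> n" and T: "real (n + 1) * h \<le> T" for h n
  proof -
    define t where "t = real n * h"
    have th: "0 \<le> t" "t + h \<le> T"
      using h T by (auto simp: t_def algebra_simps)
    have grid: "t - real m * h = real (n - m) * h" if "m \<le> n" for m
      using that by (simp add: t_def of_nat_diff left_diff_distrib)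
    define \<Delta> where "\<Delta> m = backward_diff m (\<lambda>k. N (Q (real k * h)) (real k * h)) n" for m
    have \<Delta>: "\<Delta> m = (\<Sum>l\<le>m. ((-1) ^ l * real (m choose l)) *\<^sub>R D 0 (t + (- real l) * h))" if "m < p" for m
      unfolding \<Delta>_def backward_diff_def D0
    proof (intro sum.cong refl arg_cong2[where f = scaleR])
      fix l assume "l \<in> {..m}"
      then have "real (n - l) * h = t + (- real l) * h"
        using that n grid[of l] by simp
      then show "N (Q (real (n - l) * h)) (real (n - l) * h) = N (Q (t + - real l * h)) (t + - real l * h)"
        by simp
    qed
    have \<Delta>_le: "norm (\<Delta> m) \<le> 2 ^ m * (B * (real m * h) ^ m)" if "m < p" for m
    proof -
      have "m \<le> n" using that n by simp
      then have "0 \<le> t - real m * h"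
        unfolding grid[OF \<open>m \<le> n\<close>] using h by simp
      then show ?thesis
        unfolding \<Delta>[OF that] using that h th
        by (intro norm_backward_difference_le_power) simp_all
    qed
    have interp: "norm (D 0 (t + \<theta> * h) - (\<Sum>m<p. newton_weight m \<theta> *\<^sub>R \<Delta> m))
        \<le> 2 ^ p * (B * (real p * h) ^ p)" if "\<theta> \<in> {0..1}" for \<theta>
    proof -
      have "(real p - 1) * h = real (p - 1) * h" using \<open>1 \<le> p\<close> by (simp add: of_nat_diff)
      then have "t - (real p - 1) * h = real (n - (p - 1)) * h"
        using grid[OF n] by (rule subst[where P = "\<lambda>x. t - x = _", OF sym])
      then have "0 \<le> t - (real p - 1) * h"
        using h by simp
      from newton_backward_error_power[OF \<open>1 \<le> p\<close> _ this th(2) that] h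
      have "norm (D 0 (t + \<theta> * h) - (\<Sum>m<p. newton_weight m \<theta> *\<^sub>R
            (\<Sum>l\<le>m. ((-1) ^ l * real (m choose l)) *\<^sub>R D 0 (t + (- real l) * h))))
           \<le> 2 ^ p * (B * (real p * h) ^ p)"
        by simp
      also have "(\<Sum>m<p. newton_weight m \<theta> *\<^sub>R
            (\<Sum>l\<le>m. ((-1) ^ l * real (m choose l)) *\<^sub>R D 0 (t + (- real l) * h)))
          = (\<Sum>m<p. newton_weight m \<theta> *\<^sub>R \<Delta> m)"
        by (intro sum.cong refl arg_cong2[where f = scaleR] \<Delta>[symmetric]) simp
      finally show ?thesis .
    qed
    define W where "W s X = bexp (s *\<^sub>R L) * X * bexp (s *\<^sub>R R)" for s X
    have W: "bounded_linear (W s)" for s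
      unfolding W_def
      by (intro bounded_linear_compose[OF bounded_linear_mult_left] bounded_linear_mult_right)
    define V where "V m s = bexp (s *\<^sub>R (L + R)) *
        (\<Sum>j<p - m. (s ^ j / fact j) *\<^sub>R (ad R ^^ j) (\<Delta> m))" for m s
    define S where "S \<theta> = (1 - \<theta>) * h" for \<theta>
    have S: "S \<theta> \<in> {0..h}" if "\<theta> \<in> {0..1}" for \<theta>
      using that h mult_right_mono[of "1 - \<theta>" 1 h] by (simp add: S_def)
    \<comment> \<open>The constants are uniform because no step is longer than the whole interval.\<close>
    have hT: "h \<le> T" using th by simp
    have "((\<lambda>\<theta>. h *\<^sub>R W (S \<theta>) (D 0 (t + \<theta> * h))
              - h *\<^sub>R (\<Sum>m<p. newton_weight m \<theta> *\<^sub>R V m (S \<theta>)))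
        has_integral (Q (t + h) - bexp (h *\<^sub>R L) * Q t * bexp (h *\<^sub>R R))
          - metd_increment p L R N h (\<lambda>k. Q (real k * h)) n) {0..1}"
      unfolding W_def V_def S_def D0 \<Delta>_def
      using th h by (intro has_integral_diff variation_of_constants[OF Q] metd_increment_has_integral) auto
    also have "(Q (t + h) - bexp (h *\<^sub>R L) * Q t * bexp (h *\<^sub>R R))
          - metd_increment p L R N h (\<lambda>k. Q (real k * h)) n = metd_defect p L R N Q h n"
      by (simp add: metd_defect_def metd_step_def t_def algebra_simps)
    finally have int: "((\<lambda>\<theta>. h *\<^sub>R W (S \<theta>) (D 0 (t + \<theta> * h))
              - h *\<^sub>R (\<Sum>m<p. newton_weight m \<theta> *\<^sub>R V m (S \<theta>)))
        has_integral metd_defect p L R N Q h n) {0..1}" .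
    have "norm (metd_defect p L R N Q h n) \<le> (h * (K * h ^ p)) * measure lborel {0..1::real}"
    proof (rule has_integral_bound_real[where S = "{}", OF _ _ int])
      show "0 \<le> h * (K * h ^ p)" using K_nonneg h by simp
      fix \<theta> :: real assume "\<theta> \<in> {0..1} - {}"
      then have \<theta>: "\<theta> \<in> {0..1}" by simp
      define s where "s = S \<theta>"
      have s: "0 \<le> s" "s \<le> h" "\<bar>s\<bar> \<le> T" using S[OF \<theta>] hT by (auto simp: s_def)
      define I where "I = (\<Sum>m<p. newton_weight m \<theta> *\<^sub>R \<Delta> m)"
      interpret W: bounded_linear "W s" by (rule W)
      have "W s I = (\<Sum>m<p. newton_weight m \<theta> *\<^sub>R W s (\<Delta> m))"
        by (simp add: I_def W.sum W.scaleR)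
      \<comment> \<open>The interpolation error under the exact flow, and the expansion error on each difference.\<close>
      then have split: "W s (D 0 (t + \<theta> * h)) - (\<Sum>m<p. newton_weight m \<theta> *\<^sub>R V m s)
          = W s (D 0 (t + \<theta> * h) - I) + (\<Sum>m<p. newton_weight m \<theta> *\<^sub>R (W s (\<Delta> m) - V m s))"
        by (simp add: W.diff sum_subtractf scaleR_diff_right)
      have "norm (W s (D 0 (t + \<theta> * h) - I)) \<le> e L * (2 ^ p * (B * (real p * h) ^ p)) * e R"
        unfolding W_def I_def using s \<theta> by (intro norm_mult3_le e interp) auto
      moreover have "norm (newton_weight m \<theta> *\<^sub>R (W s (\<Delta> m) - V m s))
          \<le> C m * (2 ^ m * (B * real m ^ m)) * h ^ p" if m: "m \<in> {..<p}" for m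
      proof -
        have "norm (newton_weight m \<theta> *\<^sub>R (W s (\<Delta> m) - V m s)) \<le> 1 * norm (W s (\<Delta> m) - V m s)"
          unfolding norm_scaleR by (intro mult_right_mono abs_newton_weight_le_1 \<theta>) simp
        also have "\<dots> \<le> C m * s ^ (p - m) * norm (\<Delta> m)"
          using C[of s "\<Delta> m" m] s by (simp add: W_def V_def)
        also have "\<dots> \<le> C m * h ^ (p - m) * (2 ^ m * (B * (real m * h) ^ m))"
          using s m C_pos[of m] by (intro mult_mono \<Delta>_le power_mono) auto
        also have "\<dots> = C m * (2 ^ m * (B * real m ^ m)) * (h ^ (p - m) * h ^ m)"
          by (simp add: power_mult_distrib mult_ac)
        also have "h ^ (p - m) * h ^ m = h ^ p"
          using m by (simp flip: power_add)
        finally show ?thesis .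
      qed
      ultimately have "norm (W s (D 0 (t + \<theta> * h)) - (\<Sum>m<p. newton_weight m \<theta> *\<^sub>R V m s))
          \<le> e L * (2 ^ p * (B * (real p * h) ^ p)) * e R + (\<Sum>m<p. C m * (2 ^ m * (B * real m ^ m)) * h ^ p)"
        unfolding split by (intro order_trans[OF norm_triangle_ineq] add_mono sum_norm_le)
      also have "\<dots> = K * h ^ p"
        by (simp add: K_def power_mult_distrib ring_distribs sum_distrib_left sum_distrib_right mult_ac)
      finally show "norm (h *\<^sub>R W (S \<theta>) (D 0 (t + \<theta> * h))
              - h *\<^sub>R (\<Sum>m<p. newton_weight m \<theta> *\<^sub>R V m (S \<theta>))) \<le> h * (K * h ^ p)"
        using h by (simp add: s_def flip: scaleR_diff_right)
    qed simp
    then show ?thesis by (simp add: mult_ac)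
  qed
  then show ?thesis by blast
qed

section \<open>Consistency\<close>

theorem theorem1:
  fixes L R Q\<^sub>0 :: "'a::{real_normed_algebra, real_algebra_1, banach}"
    and N :: "'a \<Rightarrow> real \<Rightarrow> 'a"
    and Q :: "real \<Rightarrow> 'a"
    and T \<rho> L\<^sub>N :: real
    and p :: nat
  assumes "0 < T" and "1 \<le> p"
    and "L * R - R * L = 0"
    and "\<And>t. t \<in> {0..T} \<Longrightarrow>
           (Q has_vector_derivative L * Q t + Q t * R + N (Q t) t) (at t within {0..T})"
    and "Q 0 = Q\<^sub>0"
    and "generates_analytic_semigroup L"
    and "generates_analytic_semigroup R"
    and "generates_analytic_semigroup (L + R)"
    and "0 < \<rho>" and "0 \<le> L\<^sub>N"
    and "\<And>t X Y. t \<in> {0..T} \<Longrightarrow> norm (X - Q t) \<le> \<rho> \<Longrightarrow> norm (Y - Q t) \<le> \<rho> \<Longrightarrow>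
           norm (N X t - N Y t) \<le> L\<^sub>N * norm (X - Y)"
    and "Ck_on p (\<lambda>t. N (Q t) t) {0..T}"
    and "\<And>k. k \<le> p \<Longrightarrow> bounded (nth_vector_derivative k (\<lambda>t. N (Q t) t) {0..T} ` {0..T})"
  shows "(\<exists>C. \<forall>h n. 0 < h \<longrightarrow> p - 1 \<le> n \<longrightarrow> real (n + 1) * h \<le> T \<longrightarrow>
            norm (metd_defect p L R N Q h n) \<le> C * h ^ (p + 1))
         \<and> metd_consistent p p T L R N Q"
proof -
  obtain B where B: "bounded_derivatives (\<lambda>k. nth_vector_derivative k (\<lambda>t. N (Q t) t) {0..T}) T B p"
    using assms by (elim bounded_derivatives_Ck_on) auto
  have "\<exists>C. \<forall>h n. 0 < h \<longrightarrow> p - 1 \<le> n \<longrightarrow> real (n + 1) * h \<le> T \<longrightarrow>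
            norm (metd_defect p L R N Q h n) \<le> C * h ^ (p + 1)"
    using assms by (intro metd_defect_le[OF _ _ _ _ B]) auto
  then obtain C where C: "\<forall>h n. 0 < h \<longrightarrow> p - 1 \<le> n \<longrightarrow> real (n + 1) * h \<le> T \<longrightarrow>
            norm (metd_defect p L R N Q h n) \<le> C * h ^ (p + 1)" ..
  have "\<forall>\<^sub>F h in at_right 0. \<forall>n. p - 1 \<le> n \<longrightarrow> real (n + 1) * h \<le> T \<longrightarrow>
        norm (metd_defect p L R N Q h n) \<le> C * h ^ (p + 1)"
    using C by (auto simp: eventually_at_right_field intro!: exI[of _ 1])
  with C show ?thesis
    unfolding metd_consistent_def by blast
qed

end
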